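(* Generically, the $H_5$-Clifford algebra $\mathfrak{C}(A:B:C)$ is a regular graded Clifford algebra; that is, there is a nonempty Zariski-open subset of $\mathbb{P}^2$ (over $\mathbb{C}$) such that for every point $(A:B:C)$ in it, $\mathfrak{C}(A:B:C)$ is a regular graded Clifford algebra.
   Context: Indices are in $\mathbb{Z}/5\mathbb{Z}$. For $(A:B:C)\in\mathbb{P}^2$ (over $\mathbb{C}$), $\mathfrak{C}(A:B:C)$ is the quotient of $\mathbb{C}\langle x_0,\ldots,x_4\rangle$ (generators in degree $1$) by the relations, for $k\in\mathbb{Z}/5\mathbb{Z}$, $$C(x_{k+1}x_{k-1}+x_{k-1}x_{k+1})=Ax_k^2,\qquad C(x_{k+2}x_{k-2}+x_{k-2}x_{k+2})=Bx_k^2,$$ $$B(x_{k+1}x_{k-1}+x_{k-1}x_{k+1})=A(x_{k+2}x_{k-2}+x_{k-2}x_{k+2}).$$ A graded Clifford algebra associated with symmetric matrices $M_0,\ldots,M_4\in\mathbf{M}_5(\mathbb{C})$ is the algebra with degree $1$ generators $x_0,\ldots,x_4$ and degree $2$ central generators $y_0,\ldots,y_4$ with relations $x_ix_j+x_jx_i=\sum_k(M_k)_{ij}y_k$; here $y_k=x_k^2$. Its quadric system consists of the quadrics $q_k=[z_0,\ldots,z_4]M_k[z_0,\ldots,z_4]^{T}$. Here (up to a factor) $q_k=Cz_k^2+Az_{k+1}z_{k-1}+Bz_{k+2}z_{k-2}$. "Regular" means that the quadric system is base-point free (the $q_k$ have no common zero in $\mathbb{P}^4$), which by a known theorem is equivalent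 to the graded Clifford algebra being quadratic, Auslander-regular of global dimension $5$, Cohen-Macaulay and with Hilbert series $\frac{1}{(1-t)^5}$; in that case it is also a noetherian domain and Artin-Schelter regular. *)

theory Defs
  imports
    "HOL-Analysis.Analysis"
    "HOL-Algebra.QuotRing"
    "HOL-Algebra.Module"
    "HOL-Library.Poly_Mapping"
begin

section \<open>Projective space and its Zariski topology\<close>

text \<open>A point of projective space is the punctured line through a nonzero vector, so
  \<open>proj_point (vector [A, B, C])\<close> is the point \<open>(A:B:C)\<close>; \<open>proj_point 0 = {0}\<close> is not a point.\<close>

definition proj_point :: "complex ^ 'n \<Rightarrow> (complex ^ 'n) set" where
  "proj_point v = {c *s v | c. c \<noteq> 0}"

definition proj_space :: "(complex ^ 'n) set set" where
  "proj_space = {proj_point v | v. v \<noteq> 0}"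

text \<open>Commutative polynomials in variables indexed by \<open>'n\<close>, as finitely supported families of
  coefficients indexed by exponent vectors.\<close>

type_synonym 'n cpoly = "('n \<Rightarrow>\<^sub>0 nat) \<Rightarrow>\<^sub>0 complex"

definition cpoly_eval :: "'n::finite cpoly \<Rightarrow> complex ^ 'n \<Rightarrow> complex" where
  "cpoly_eval p v = (\<Sum>m\<in>Poly_Mapping.keys p. Poly_Mapping.lookup p m * (\<Prod>i\<in>UNIV. (v $ i) ^ Poly_Mapping.lookup m i))"

definition cpoly_homogeneous :: "nat \<Rightarrow> 'n::finite cpoly \<Rightarrow> bool" where
  "cpoly_homogeneous d p \<longleftrightarrow> (\<forall>m\<in>Poly_Mapping.keys p. (\<Sum>i\<in>UNIV. Poly_Mapping.lookup m i) = d)"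

definition proj_zeros :: "'n::finite cpoly set \<Rightarrow> (complex ^ 'n) set set" where
  "proj_zeros S = {proj_point v | v. v \<noteq> 0 \<and> (\<forall>p\<in>S. cpoly_eval p v = 0)}"

definition zariski_closed :: "(complex ^ 'n::finite) set set \<Rightarrow> bool" where
  "zariski_closed Z \<longleftrightarrow> (\<exists>S. (\<forall>p\<in>S. \<exists>d. cpoly_homogeneous d p) \<and> Z = proj_zeros S)"

definition zariski_open :: "(complex ^ 'n::finite) set set \<Rightarrow> bool" where
  "zariski_open U \<longleftrightarrow> U \<subseteq> proj_space \<and> zariski_closed (proj_space - U)"


section \<open>Free algebras\<close>

text \<open>The free monoid, written additively because the convolution product of
  \<^theory>\<open>HOL-Library.Poly_Mapping\<close> is based on \<open>+\<close>; finitely supported functions on it then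
  form the free complex algebra.\<close>

datatype 'x fword = FWord (letters: "'x list")

instantiation fword :: (type) monoid_add
begin

definition zero_fword :: "'x fword" where
  "zero_fword = FWord []"

definition plus_fword :: "'x fword \<Rightarrow> 'x fword \<Rightarrow> 'x fword" where
  "plus_fword u v = FWord (letters u @ letters v)"

instance
  by standard (simp_all add: zero_fword_def plus_fword_def)

end

type_synonym 'x free_alg = "'x fword \<Rightarrow>\<^sub>0 complex"

definition gen :: "'x \<Rightarrow> 'x free_alg" where
  "gen x = Poly_Mapping.single (FWord [x]) 1"

definition scalar :: "complex \<Rightarrow> 'x free_alg" where
  "scalar c = Poly_Mapping.single 0 c"

definition free_ring :: "'x free_alg ring" where
  "free_ring = \<lparr>carrier = UNIV, mult = (*), one = 1, zero = 0, add = (+)\<rparr>"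

lemma ring_free_ring: "ring (free_ring :: 'x free_alg ring)"
proof (rule ringI)
  show "abelian_group (free_ring :: 'x free_alg ring)"
  proof (rule abelian_groupI)
    fix x :: "'x free_alg"
    have "- x + x = 0" by simp
    then show "\<exists>y\<in>carrier free_ring. y \<oplus>\<^bsub>free_ring\<^esub> x = \<zero>\<^bsub>free_ring\<^esub>"
      unfolding free_ring_def by (auto intro: exI[of _ "- x"])
  qed (simp_all add: free_ring_def algebra_simps)
  show "Group.monoid (free_ring :: 'x free_alg ring)"
    by (rule Group.monoidI) (simp_all add: free_ring_def algebra_simps)
qed (simp_all add: free_ring_def algebra_simps)

text \<open>Homogeneous elements of degree \<open>n\<close>, for the grading in which the generator \<open>x\<close> has
  degree \<open>wt x\<close>.\<close>

definition homogeneous :: "('x \<Rightarrow> nat) \<Rightarrow> nat \<Rightarrow> 'x free_alg \<Rightarrow> bool" where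
  "homogeneous wt n a \<longleftrightarrow> (\<forall>w\<in>Poly_Mapping.keys a. sum_list (map wt (letters w)) = n)"


section \<open>Graded algebras given by generators and relations\<close>

record 'b graded_algebra = "(complex, 'b) module" +
  component :: "nat \<Rightarrow> 'b set"

text \<open>The quotient of the free algebra by the two-sided ideal generated by \<open>R\<close>. The components
  form a grading when the elements of \<open>R\<close> are homogeneous, as in both uses below.\<close>

definition presented_algebra ::
    "('x \<Rightarrow> nat) \<Rightarrow> 'x free_alg set \<Rightarrow> 'x free_alg set graded_algebra" where
  "presented_algebra wt R =
     (let I = genideal free_ring R; Q = free_ring Quot I in
      \<lparr>carrier = carrier Q, mult = mult Q, one = one Q, zero = zero Q, add = add Q,
       smult = (\<lambda>c X. \<Union>a\<in>X. I +>\<^bsub>free_ring\<^esub> (scalar c * a)),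
       component = (\<lambda>n. {I +>\<^bsub>free_ring\<^esub> a | a. homogeneous wt n a})\<rparr>)"

definition graded_algebra_iso :: "'a graded_algebra \<Rightarrow> 'b graded_algebra \<Rightarrow> ('a \<Rightarrow> 'b) set" where
  "graded_algebra_iso S T =
     {h \<in> ring_iso S T.
        (\<forall>c. \<forall>a\<in>carrier S. h (c \<odot>\<^bsub>S\<^esub> a) = c \<odot>\<^bsub>T\<^esub> h a) \<and>
        (\<forall>n. h ` component S n = component T n)}"


section \<open>Graded Clifford algebras\<close>

text \<open>The numeral type \<open>5\<close> is the ring of integers modulo 5, so the arithmetic on indices
  below is modulo 5. The numeral \<open>5\<close> itself denotes \<open>0\<close> in it.\<close>

datatype clifford_gen = X 5 | Y 5

primrec clifford_wt :: "clifford_gen \<Rightarrow> nat" where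
  "clifford_wt (X i) = 1"
| "clifford_wt (Y k) = 2"

definition clifford_relations :: "(5 \<Rightarrow> complex ^ 5 ^ 5) \<Rightarrow> clifford_gen free_alg set" where
  "clifford_relations M =
     {gen (X i) * gen (X j) + gen (X j) * gen (X i) - (\<Sum>k\<in>UNIV. scalar (M k $ i $ j) * gen (Y k))
       | i j. True}
   \<union> {gen (Y k) * gen g - gen g * gen (Y k) | k g. True}"

definition graded_clifford_algebra ::
    "(5 \<Rightarrow> complex ^ 5 ^ 5) \<Rightarrow> clifford_gen free_alg set graded_algebra" where
  "graded_clifford_algebra M = presented_algebra clifford_wt (clifford_relations M)"

definition quadric :: "complex ^ 5 ^ 5 \<Rightarrow> complex ^ 5 \<Rightarrow> complex" where
  "quadric N z = (\<Sum>i\<in>UNIV. \<Sum>j\<in>UNIV. z $ i * N $ i $ j * z $ j)"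

definition base_locus :: "(5 \<Rightarrow> complex ^ 5 ^ 5) \<Rightarrow> (complex ^ 5) set set" where
  "base_locus M = {proj_point z | z. z \<noteq> 0 \<and> (\<forall>k. quadric (M k) z = 0)}"

text \<open>Base-point freeness does not depend on the choice of \<open>M\<close>: a graded isomorphism changes
  the generators of degree 1 linearly, and preserves the span of the anticommutators of elements
  of degree 1. So it preserves the linear system of quadrics up to a linear change of variables
  in case the \<open>M k\<close> are linearly independent; otherwise there are base points.\<close>

definition regular_graded_clifford_algebra :: "'a graded_algebra \<Rightarrow> bool" where
  "regular_graded_clifford_algebra S \<longleftrightarrow>
     (\<exists>M. (\<forall>k. transpose (M k) = M k) \<and>
          graded_algebra_iso S (graded_clifford_algebra M) \<noteq> {} \<and>
          base_locus M = {})"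


section \<open>The \<open>H\<^sub>5\<close>-Clifford algebra\<close>

definition H5_relations :: "complex \<Rightarrow> complex \<Rightarrow> complex \<Rightarrow> 5 free_alg set" where
  "H5_relations A B C = (let x = gen in
     (\<Union>k::5.
       {scalar C * (x (k + 1) * x (k - 1) + x (k - 1) * x (k + 1)) - scalar A * x k ^ 2,
        scalar C * (x (k + 2) * x (k - 2) + x (k - 2) * x (k + 2)) - scalar B * x k ^ 2,
        scalar B * (x (k + 1) * x (k - 1) + x (k - 1) * x (k + 1))
          - scalar A * (x (k + 2) * x (k - 2) + x (k - 2) * x (k + 2))}))"

definition H5_clifford_algebra ::
    "complex \<Rightarrow> complex \<Rightarrow> complex \<Rightarrow> 5 free_alg set graded_algebra" where
  "H5_clifford_algebra A B C = presented_algebra (\<lambda>_. 1) (H5_relations A B C)"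

text \<open>The algebra depends only on the point \<open>(A:B:C)\<close>.\<close>

lemma H5_relations_scale:
  assumes "c \<noteq> 0"
  shows "H5_relations (c * A) (c * B) (c * C) = (\<lambda>r. scalar c * r) ` H5_relations A B C"
proof -
  have s: "scalar (c * d) = (scalar c * scalar d :: 5 free_alg)" for d
    by (simp add: scalar_def mult_single)
  show ?thesis
    unfolding H5_relations_def Let_def s image_UN
    by (simp add: right_diff_distrib mult.assoc)
qed

lemma H5_clifford_algebra_scale:
  assumes "c \<noteq> 0"
  shows "H5_clifford_algebra (c * A) (c * B) (c * C) = H5_clifford_algebra A B C"
proof -
  have sc: "(\<lambda>r. scalar c * r) ` R \<subseteq> J \<longleftrightarrow> R \<subseteq> J"
    if J: "ideal J (free_ring :: 5 free_alg ring)" for R J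
  proof -
    have cl: "scalar d * a \<in> J" if "a \<in> J" for d a
      using ideal.I_l_closed[OF J that, of "scalar d"] by (simp add: free_ring_def)
    have inv: "scalar (inverse c) * (scalar c * a) = a" for a :: "5 free_alg"
      using assms by (simp add: scalar_def mult_single single_one flip: mult.assoc)
    show ?thesis
      by (auto intro: cl) (metis cl imageI inv subsetD)
  qed
  have "genideal free_ring (H5_relations (c * A) (c * B) (c * C))
      = genideal free_ring (H5_relations A B C)"
    unfolding genideal_def H5_relations_scale[OF assms] using sc by (metis (lifting))
  then show ?thesis
    by (simp add: H5_clifford_algebra_def presented_algebra_def)
qed

end

theory Submission
  imports Defs
begin

text \<open>Write \<open>a = A / C\<close>, \<open>b = B / C\<close> and \<open>p = a b\<close>. Over the part of the plane where \<open>C \<noteq> 0\<close>, the relations of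
  the \<open>H\<^sub>5\<close>-Clifford algebra say that every anticommutator \<open>x\<^sub>i x\<^sub>j + x\<^sub>j x\<^sub>i\<close> is a multiple of the
  square \<open>x\<^sub>m ^ 2\<close>, where \<open>m = (i + j) / 2\<close> modulo 5. Two facts remain: these squares have to be
  central, so that they can serve as the generators \<open>y\<^sub>m\<close> of a graded Clifford algebra, and the
  resulting five quadrics \<open>z\<^sub>k ^ 2 + a z\<^bsub>k+1\<^esub> z\<^bsub>k-1\<^esub> + b z\<^bsub>k+2\<^esub> z\<^bsub>k-2\<^esub>\<close> must have no common zero.

  Centrality comes from the identity \<open>[x ^ 2, y] = [x, x y + y x]\<close>. It expresses \<open>[x\<^sub>k ^ 2, x\<^sub>j]\<close> as
  a multiple of \<open>[x\<^sub>m ^ 2, x\<^sub>k]\<close>. The step \<open>(k, j) \<mapsto> (m, k)\<close> doubles the difference of the indices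
  modulo 5, and its fourth iterate is the identity, so each commutator equals \<open>p ^ 2\<close> times
  itself. Hence it vanishes unless \<open>p ^ 2 = 1\<close> (\<open>squares_central_mod_H5_relations\<close>). The map that
  sends each \<open>x\<^sub>k\<close> to \<open>x\<^sub>k\<close> is then an isomorphism, with the inverse sending \<open>y\<^sub>k\<close> to \<open>x\<^sub>k ^ 2\<close>
  (\<open>presented_algebra_iso\<close>, \<open>H5_clifford_algebra_iso_graded_clifford_algebra\<close>).

  For the base points, multiply each quadric by the one coordinate that makes all five cubics have
  the same weight under the diagonal symmetry of order 5. Modulo these cubics, generically, all
  seven monomials of that weight are combinations of \<open>u = z\<^sub>0 z\<^sub>1 z\<^sub>4\<close> and \<open>v = z\<^sub>0 z\<^sub>2 z\<^sub>3\<close>, and the two multiplicative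
  relations between the monomials become two binary cubic forms in \<open>u\<close> and \<open>v\<close>. Eliminating \<open>v / u\<close>
  shows that they have no common zero unless an explicit polynomial in \<open>a\<close> and \<open>b\<close> vanishes
  (\<open>no_common_root\<close>). So generically \<open>u = v = 0\<close>, then \<open>z\<^sub>0 = 0\<close>, and by the cyclic symmetry all
  coordinates vanish (\<open>quadrics_imp_coordinate_zero\<close>).

  All conditions used along the way are homogenised and multiplied into one form of degree 14, and
  its nonvanishing locus is the open set. It contains the point \<open>(1:1:2)\<close>.\<close>

section \<open>Evaluating finitely supported functions on a monoid\<close>

lemma poly_mapping_additive_induct [case_names single add]:
  assumes single: "\<And>m c. P (Poly_Mapping.single m c)"
    and add: "\<And>p q. P p \<Longrightarrow> P q \<Longrightarrow> P (p + q)"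
  shows "P (p :: 'm \<Rightarrow>\<^sub>0 'k::monoid_add)"
proof (induction p rule: update_induct)
  case const
  show ?case using single[of _ 0] by simp
next
  case (update f a b)
  have "Poly_Mapping.update a b f = f + Poly_Mapping.single a b"
    using update(1)
    by (intro poly_mapping_eqI) (auto simp: lookup_update lookup_add
        lookup_single when_def not_in_keys_iff_lookup_eq_zero)
  then show ?case using add[OF update(3) single] by simp
qed

text \<open>The universal property of a monoid algebra: a monoid homomorphism \<open>h\<close>, together with a
  compatible map \<open>c\<close> of the coefficients into the centre, extends to a ring homomorphism. Evaluation
  of commutative polynomials and substitution in free algebras are the two instances below.\<close>
locale monoid_algebra_map =
  fixes c :: "'k::comm_ring_1 \<Rightarrow> 'r::ring_1" and h :: "'m::monoid_add \<Rightarrow> 'r"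
  assumes c_add: "c (x + y) = c x + c y"
    and c_mult: "c (x * y) = c x * c y"
    and c_one: "c 1 = 1"
    and c_central: "c x * r = r * c x"
    and h_zero: "h 0 = 1"
    and h_add: "h (m + n) = h m * h n"
begin

definition extend :: "('m \<Rightarrow>\<^sub>0 'k) \<Rightarrow> 'r" where
  "extend p = (\<Sum>m\<in>Poly_Mapping.keys p. c (Poly_Mapping.lookup p m) * h m)"

lemma c_zero: "c 0 = 0"
  using c_add[of 0 0] by simp

lemma extend_eq_sum:
  assumes "finite S" "Poly_Mapping.keys p \<subseteq> S"
  shows "extend p = (\<Sum>m\<in>S. c (Poly_Mapping.lookup p m) * h m)"
  unfolding extend_def using assms
  by (intro sum.mono_neutral_left) (auto simp: not_in_keys_iff_lookup_eq_zero c_zero)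

lemma extend_single: "extend (Poly_Mapping.single m x) = c x * h m"
  by (subst extend_eq_sum[of "{m}"]) (auto simp: lookup_single)

lemma extend_add: "extend (p + q) = extend p + extend q"
proof -
  let ?S = "Poly_Mapping.keys p \<union> Poly_Mapping.keys q"
  have "extend r = (\<Sum>m\<in>?S. c (Poly_Mapping.lookup r m) * h m)" if "r \<in> {p, q, p + q}" for r
    using that keys_add[of p q] by (intro extend_eq_sum) auto
  then show ?thesis
    by (simp add: lookup_add c_add distrib_right sum.distrib)
qed

lemma extend_one: "extend 1 = 1"
  using extend_single[of 0 1] by (simp add: c_one h_zero)

lemma extend_diff: "extend (p - q) = extend p - extend q"
  using extend_add[of "p - q" q] by simp

lemma extend_mult: "extend (p * q) = extend p * extend q"
proof (induction p rule: poly_mapping_additive_induct)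
  case (single m x)
  show ?case
  proof (induction q rule: poly_mapping_additive_induct)
    case (single n y)
    have "c (x * y) * h (m + n) = c x * (c y * h m) * h n"
      by (simp add: c_mult h_add mult.assoc)
    also have "\<dots> = c x * h m * (c y * h n)"
      by (simp only: c_central[of y "h m"] mult.assoc)
    finally show ?case by (simp add: mult_single extend_single)
  qed (simp add: distrib_left extend_add)
qed (simp add: distrib_right extend_add)

end

lemma keys_mult_degree:
  fixes d :: "'m::monoid_add \<Rightarrow> 'n::monoid_add" and p q :: "'m \<Rightarrow>\<^sub>0 'k::semiring_0"
  assumes "\<And>m n. d (m + n) = d m + d n"
    and "\<forall>m\<in>Poly_Mapping.keys p. d m = i" "\<forall>m\<in>Poly_Mapping.keys q. d m = j"
  shows "\<forall>m\<in>Poly_Mapping.keys (p * q). d m = i + j"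
  using keys_mult[of p q] assms by fastforce

section \<open>Commutative polynomials and nonvanishing loci\<close>

interpretation cpoly: monoid_algebra_map
  "\<lambda>x::complex. x" "\<lambda>m. \<Prod>i\<in>UNIV. (v $ i) ^ Poly_Mapping.lookup m i"
  rewrites "monoid_algebra_map.extend (\<lambda>x. x) (\<lambda>m. \<Prod>i\<in>UNIV. (v $ i) ^ Poly_Mapping.lookup m i) p
    = cpoly_eval p v"
  for v :: "complex ^ 'n::finite" and p
proof -
  show *: "monoid_algebra_map (\<lambda>x::complex. x) (\<lambda>m. \<Prod>i\<in>UNIV. (v $ i) ^ Poly_Mapping.lookup m i)"
    for v :: "complex ^ 'n"
    by standard (simp_all add: lookup_add power_add prod.distrib)
  show "monoid_algebra_map.extend (\<lambda>x. x) (\<lambda>m. \<Prod>i\<in>UNIV. (v $ i) ^ Poly_Mapping.lookup m i) p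
    = cpoly_eval p v"
    by (simp add: monoid_algebra_map.extend_def[OF *] cpoly_eval_def)
qed

lemma cpoly_eval_scale:
  assumes "cpoly_homogeneous d p"
  shows "cpoly_eval p (c *s v) = c ^ d * cpoly_eval p v"
  unfolding cpoly_eval_def sum_distrib_left
proof (rule sum.cong)
  fix m assume "m \<in> Poly_Mapping.keys p"
  then have d: "(\<Sum>i\<in>UNIV. Poly_Mapping.lookup m i) = d"
    using assms by (simp add: cpoly_homogeneous_def)
  show "Poly_Mapping.lookup p m * (\<Prod>i\<in>UNIV. (c *s v) $ i ^ Poly_Mapping.lookup m i)
      = c ^ d * (Poly_Mapping.lookup p m * (\<Prod>i\<in>UNIV. v $ i ^ Poly_Mapping.lookup m i))"
    by (simp add: power_mult_distrib prod.distrib d flip: power_sum)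
qed simp

lemma mem_proj_point: "v \<in> proj_point v"
  unfolding proj_point_def by (force intro: exI[of _ 1])

text \<open>Homogeneity makes nonvanishing independent of the representative of a point, so that the open
  set determined by a form can be tested on any representative.\<close>
lemma nonvanishing_locus:
  assumes "cpoly_homogeneous d p"
  obtains U where "zariski_open U"
    and "\<And>v. proj_point v \<in> U \<longleftrightarrow> v \<noteq> 0 \<and> cpoly_eval p v \<noteq> 0"
proof (rule that)
  let ?U = "proj_space - proj_zeros {p}"
  show "zariski_open ?U"
    unfolding zariski_open_def zariski_closed_def
    using assms by (auto simp: proj_space_def proj_zeros_def intro!: exI[of _ "{p}"])
  show "proj_point v \<in> ?U \<longleftrightarrow> v \<noteq> 0 \<and> cpoly_eval p v \<noteq> 0" for v
  proof -
    have "v \<noteq> 0 \<and> cpoly_eval p v \<noteq> 0"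
      if "proj_point v = proj_point w" "w \<noteq> 0" "cpoly_eval p w \<noteq> 0" for w
    proof -
      from that(1) mem_proj_point[of w] obtain c where "w = c *s v"
        unfolding proj_point_def by auto
      then show ?thesis using that cpoly_eval_scale[OF assms, of c v] by auto
    qed
    moreover have "proj_point v \<in> ?U \<longleftrightarrow>
        (\<exists>w. proj_point v = proj_point w \<and> w \<noteq> 0) \<and>
        \<not> (\<exists>w. proj_point v = proj_point w \<and> w \<noteq> 0 \<and> cpoly_eval p w = 0)"
      by (auto simp: proj_space_def proj_zeros_def)
    moreover have "cpoly_eval p w \<noteq> 0" if "proj_point v = proj_point w" "v \<noteq> 0" "cpoly_eval p v \<noteq> 0" for w
    proof -
      from that(1) mem_proj_point[of v] obtain c where "v = c *s w"
        unfolding proj_point_def by auto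
      then show ?thesis using that cpoly_eval_scale[OF assms, of c w] by auto
    qed
    ultimately show ?thesis by metis
  qed
qed

definition cvar :: "'n \<Rightarrow> 'n cpoly" where
  "cvar i = Poly_Mapping.single (Poly_Mapping.single i 1) 1"

definition cconst :: "complex \<Rightarrow> 'n cpoly" where
  "cconst c = Poly_Mapping.single 0 c"

lemma cpoly_eval_cvar: "cpoly_eval (cvar i) v = v $ i"
proof -
  have "(\<Prod>j\<in>UNIV. (v $ j) ^ Poly_Mapping.lookup (Poly_Mapping.single i 1) j)
      = (\<Prod>j\<in>UNIV. if j = i then v $ j else 1)"
    by (intro prod.cong) (auto simp: lookup_single when_def)
  then show ?thesis by (simp add: cvar_def cpoly.extend_single)
qed

lemma cpoly_eval_cconst: "cpoly_eval (cconst c) v = c"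
  by (simp add: cconst_def cpoly.extend_single)

lemma cpoly_eval_power: "cpoly_eval (p ^ n) v = cpoly_eval p v ^ n"
  by (induction n) (simp_all add: cpoly.extend_one cpoly.extend_mult)

lemma cpoly_homogeneous_cvar: "cpoly_homogeneous 1 (cvar i)"
  by (simp add: cpoly_homogeneous_def cvar_def lookup_single when_def)

lemma cpoly_homogeneous_cconst: "cpoly_homogeneous 0 (cconst c)"
  by (simp add: cpoly_homogeneous_def cconst_def)

lemma cpoly_homogeneous_add:
  "cpoly_homogeneous d p \<Longrightarrow> cpoly_homogeneous d q \<Longrightarrow> cpoly_homogeneous d (p + q)"
  using keys_add[of p q] by (auto simp: cpoly_homogeneous_def)

lemma cpoly_homogeneous_mult:
  assumes "cpoly_homogeneous d p" "cpoly_homogeneous e q" "d + e = n"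
  shows "cpoly_homogeneous n (p * q)"
  using assms(1,2) unfolding cpoly_homogeneous_def assms(3)[symmetric]
  by (intro keys_mult_degree) (simp_all add: lookup_add sum.distrib)

lemma cpoly_homogeneous_cvar_power: "cpoly_homogeneous n (cvar i ^ n)"
proof (induction n)
  case 0
  show ?case using cpoly_homogeneous_cconst[of 1] by (simp add: cconst_def)
next
  case (Suc n)
  show ?case
    unfolding power_Suc by (rule cpoly_homogeneous_mult[OF cpoly_homogeneous_cvar Suc]) simp
qed

section \<open>Substitution in free algebras\<close>

definition word_prod :: "('x \<Rightarrow> 'y free_alg) \<Rightarrow> 'x fword \<Rightarrow> 'y free_alg" where
  "word_prod f w = prod_list (map f (letters w))"

lemma scalar_central: "scalar c * p = p * (scalar c :: 'x free_alg)"
  by (induction p rule: poly_mapping_additive_induct)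
    (simp_all add: scalar_def mult_single mult.commute distrib_left distrib_right)

lemma scalar_zero: "scalar 0 = 0"
  and scalar_one: "scalar 1 = 1"
  and scalar_add: "scalar (c + d) = scalar c + scalar d"
  and scalar_mult: "scalar (c * d) = scalar c * scalar d"
  by (simp_all add: scalar_def single_add mult_single)

interpretation free_subst: monoid_algebra_map "scalar :: complex \<Rightarrow> 'y free_alg" "word_prod f"
  for f :: "'x \<Rightarrow> 'y free_alg"
proof
  show "scalar x * r = r * scalar x" for x and r :: "'y free_alg"
    by (rule scalar_central)
  show "word_prod f 0 = 1"
    by (simp add: word_prod_def zero_fword_def)
  show "word_prod f (m + n) = word_prod f m * word_prod f n" for m n
    by (simp add: word_prod_def plus_fword_def)
qed (simp_all add: scalar_add scalar_mult scalar_one)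

abbreviation subst :: "('x \<Rightarrow> 'y free_alg) \<Rightarrow> 'x free_alg \<Rightarrow> 'y free_alg" where
  "subst f \<equiv> free_subst.extend f"

lemma subst_gen [simp]: "subst f (gen x) = f x"
  by (simp add: gen_def free_subst.extend_single word_prod_def scalar_one)

lemma subst_scalar [simp]: "subst f (scalar c) = scalar c"
  by (simp add: scalar_def free_subst.extend_single free_subst.h_zero flip: zero_fword_def)

lemmas subst_simps [simp] = free_subst.extend_add free_subst.extend_diff
  free_subst.extend_mult free_subst.extend_one

lemma free_alg_induct [case_names scalar gen add mult]:
  assumes scalar: "\<And>c. P (scalar c)"
    and gen: "\<And>x. P (gen x)"
    and add: "\<And>a b. P a \<Longrightarrow> P b \<Longrightarrow> P (a + b)"
    and mult: "\<And>a b. P a \<Longrightarrow> P b \<Longrightarrow> P (a * b)"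
  shows "P a"
proof (induction a rule: poly_mapping_additive_induct)
  case (single w c)
  have "P (Poly_Mapping.single (FWord xs) c)" for xs
  proof (induction xs)
    case Nil
    show ?case using scalar[of c] by (simp add: scalar_def zero_fword_def)
  next
    case (Cons x xs)
    have "Poly_Mapping.single (FWord (x # xs)) c = gen x * Poly_Mapping.single (FWord xs) c"
      by (simp add: gen_def mult_single plus_fword_def)
    then show ?case using mult[OF gen Cons.IH] by simp
  qed
  then show ?case by (metis fword.collapse)
qed (rule add)

lemma homogeneous_mult:
  assumes "homogeneous wt i a" "homogeneous wt j b"
  shows "homogeneous wt (i + j) (a * b)"
  using keys_mult_degree[of "\<lambda>w. sum_list (map wt (letters w))" a i b j] assms
  by (simp add: homogeneous_def plus_fword_def)

lemma homogeneous_sum: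
  assumes "\<And>s. s \<in> S \<Longrightarrow> homogeneous wt n (a s)"
  shows "homogeneous wt n (\<Sum>s\<in>S. a s)"
  using assms
proof (induction S rule: infinite_finite_induct)
  case (insert s S)
  then show ?case using keys_add[of "a s" "\<Sum>s\<in>S. a s"] by (fastforce simp: homogeneous_def)
qed (simp_all add: homogeneous_def)

lemma homogeneous_scalar: "homogeneous wt 0 (scalar c)"
  by (simp add: homogeneous_def scalar_def zero_fword_def)

lemma homogeneous_subst:
  assumes f: "\<And>x. homogeneous wt' (wt x) (f x)" and a: "homogeneous wt n a"
  shows "homogeneous wt' n (subst f a)"
  unfolding free_subst.extend_def
proof (rule homogeneous_sum)
  fix w assume w: "w \<in> Poly_Mapping.keys a"
  have "homogeneous wt' (sum_list (map wt xs)) (prod_list (map f xs))" for xs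
  proof (induction xs)
    case Nil
    show ?case using homogeneous_scalar[of wt' 1] by (simp add: scalar_one)
  qed (simp add: f homogeneous_mult)
  then have "homogeneous wt' (0 + sum_list (map wt (letters w)))
      (scalar (Poly_Mapping.lookup a w) * word_prod f w)"
    unfolding word_prod_def by (intro homogeneous_mult homogeneous_scalar)
  then show "homogeneous wt' n (scalar (Poly_Mapping.lookup a w) * word_prod f w)"
    using a w by (simp add: homogeneous_def)
qed

section \<open>Isomorphisms of presented algebras\<close>

abbreviation rel_ideal :: "'x free_alg set \<Rightarrow> 'x free_alg set" where
  "rel_ideal R \<equiv> genideal free_ring R"

lemma ideal_rel_ideal: "ideal (rel_ideal R) free_ring"
  by (rule ring.genideal_ideal[OF ring_free_ring]) (simp add: free_ring_def)

lemma rel_ideal_closed: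
  shows rel_ideal_add: "a \<in> rel_ideal R \<Longrightarrow> b \<in> rel_ideal R \<Longrightarrow> a + b \<in> rel_ideal R"
    and rel_ideal_zero: "0 \<in> rel_ideal R"
    and rel_ideal_mult_left: "a \<in> rel_ideal R \<Longrightarrow> c * a \<in> rel_ideal R"
    and rel_ideal_mult_right: "a \<in> rel_ideal R \<Longrightarrow> a * c \<in> rel_ideal R"
    and rel_ideal_uminus: "a \<in> rel_ideal R \<Longrightarrow> - a \<in> rel_ideal R"
    and rel_ideal_diff: "a \<in> rel_ideal R \<Longrightarrow> b \<in> rel_ideal R \<Longrightarrow> a - b \<in> rel_ideal R"
    and rel_ideal_relation: "r \<in> R \<Longrightarrow> r \<in> rel_ideal R"
proof -
  interpret I: ideal "rel_ideal R" free_ring by (rule ideal_rel_ideal)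
  show add: "a + b \<in> rel_ideal R" if "a \<in> rel_ideal R" "b \<in> rel_ideal R" for a b
    using additive_subgroup.a_closed[OF I.is_additive_subgroup that] by (simp add: free_ring_def)
  show "0 \<in> rel_ideal R"
    using additive_subgroup.zero_closed[OF I.is_additive_subgroup] by (simp add: free_ring_def)
  show left: "c * a \<in> rel_ideal R" if "a \<in> rel_ideal R" for a c
    using I.I_l_closed[OF that, of c] by (simp add: free_ring_def)
  show "a * c \<in> rel_ideal R" if "a \<in> rel_ideal R" for a c
    using I.I_r_closed[OF that, of c] by (simp add: free_ring_def)
  show um: "- a \<in> rel_ideal R" if "a \<in> rel_ideal R" for a
    using left[OF that, of "- 1"] by simp
  show "a - b \<in> rel_ideal R" if "a \<in> rel_ideal R" "b \<in> rel_ideal R"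
    using add[OF that(1) um[OF that(2)]] by simp
  show "r \<in> rel_ideal R" if "r \<in> R"
    using I.genideal_self[of R] that by (auto simp: free_ring_def)
qed

text \<open>A substitution is a ring homomorphism, so the preimage of an ideal is an ideal, and it is enough
  to check the generators.\<close>
lemma subst_rel_ideal:
  assumes "\<And>r. r \<in> R \<Longrightarrow> subst f r \<in> rel_ideal S" and a: "a \<in> rel_ideal R"
  shows "subst f a \<in> rel_ideal S"
proof -
  have "ring_hom_ring free_ring free_ring (subst f)"
    by (rule ring_hom_ringI2[OF ring_free_ring ring_free_ring], rule ring_hom_memI)
      (simp_all add: free_ring_def)
  then have "ideal {a \<in> carrier free_ring. subst f a \<in> rel_ideal S} free_ring"
    by (rule ring_hom_ring.ideal_vimage) (rule ideal_rel_ideal)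
  then have "rel_ideal R \<subseteq> {a \<in> carrier free_ring. subst f a \<in> rel_ideal S}"
    by (rule ring.genideal_minimal[OF ring_free_ring]) (use assms(1) in \<open>auto simp: free_ring_def\<close>)
  then show ?thesis using a by auto
qed

definition rel_class :: "'x free_alg set \<Rightarrow> 'x free_alg \<Rightarrow> 'x free_alg set" where
  "rel_class R a = a_r_coset free_ring (rel_ideal R) a"

lemma rel_class_eq_iff: "rel_class R a = rel_class R b \<longleftrightarrow> a - b \<in> rel_ideal R"
proof -
  have eq: "rel_class R x = {i + x | i. i \<in> rel_ideal R}" for x
    by (auto simp: rel_class_def a_r_coset_def r_coset_def free_ring_def)
  show ?thesis
  proof
    assume "rel_class R a = rel_class R b"
    moreover have "a \<in> rel_class R a"
      unfolding eq using rel_ideal_zero[of R] by force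
    ultimately show "a - b \<in> rel_ideal R" unfolding eq by force
  next
    assume d: "a - b \<in> rel_ideal R"
    have "\<exists>j. i + a = j + b \<and> j \<in> rel_ideal R" if "i \<in> rel_ideal R" for i
      using rel_ideal_add[OF that d] by (intro exI[of _ "i + (a - b)"]) simp
    moreover have "\<exists>j. i + b = j + a \<and> j \<in> rel_ideal R" if "i \<in> rel_ideal R" for i
      using rel_ideal_diff[OF that d] by (intro exI[of _ "i - (a - b)"]) simp
    ultimately show "rel_class R a = rel_class R b" unfolding eq by blast
  qed
qed

lemma mem_rel_class_iff: "b \<in> rel_class R a \<longleftrightarrow> rel_class R b = rel_class R a"
proof -
  have "b \<in> rel_class R a \<longleftrightarrow> (\<exists>i\<in>rel_ideal R. b = i + a)"
    by (auto simp: rel_class_def a_r_coset_def r_coset_def free_ring_def)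
  also have "\<dots> \<longleftrightarrow> b - a \<in> rel_ideal R" by force
  finally show ?thesis by (simp add: rel_class_eq_iff)
qed

lemma presented_algebra_simps:
  shows "carrier (presented_algebra wt R) = range (rel_class R)"
    and "rel_class R a \<otimes>\<^bsub>presented_algebra wt R\<^esub> rel_class R b = rel_class R (a * b)"
    and "rel_class R a \<oplus>\<^bsub>presented_algebra wt R\<^esub> rel_class R b = rel_class R (a + b)"
    and "\<one>\<^bsub>presented_algebra wt R\<^esub> = rel_class R 1"
    and "c \<odot>\<^bsub>presented_algebra wt R\<^esub> rel_class R a = rel_class R (scalar c * a)"
    and "component (presented_algebra wt R) n = {rel_class R a | a. homogeneous wt n a}"
proof -
  interpret I: ideal "rel_ideal R" free_ring by (rule ideal_rel_ideal)
  note defs = presented_algebra_def Let_def FactRing_def rel_class_def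
  show "carrier (presented_algebra wt R) = range (rel_class R)"
    by (auto simp: defs A_RCOSETS_def RCOSETS_def a_r_coset_def free_ring_def)
  show "rel_class R a \<otimes>\<^bsub>presented_algebra wt R\<^esub> rel_class R b = rel_class R (a * b)"
    using I.rcoset_mult_add[of a b] by (simp add: defs) (simp add: free_ring_def)
  show "rel_class R a \<oplus>\<^bsub>presented_algebra wt R\<^esub> rel_class R b = rel_class R (a + b)"
    using I.a_rcos_sum[of a b] by (simp add: defs) (simp add: free_ring_def)
  show "\<one>\<^bsub>presented_algebra wt R\<^esub> = rel_class R 1"
    by (simp add: defs) (simp add: free_ring_def)
  show "component (presented_algebra wt R) n = {rel_class R a | a. homogeneous wt n a}"
    by (simp add: defs)
  have "(\<Union>b\<in>rel_class R a. rel_class R (scalar c * b)) = rel_class R (scalar c * a)"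
  proof -
    have "rel_class R (scalar c * b) = rel_class R (scalar c * a)" if "b \<in> rel_class R a" for b
      using that rel_ideal_mult_left[of "b - a" R "scalar c"]
      by (simp add: mem_rel_class_iff rel_class_eq_iff right_diff_distrib)
    moreover have "a \<in> rel_class R a" by (simp add: mem_rel_class_iff)
    ultimately show ?thesis by blast
  qed
  then show "c \<odot>\<^bsub>presented_algebra wt R\<^esub> rel_class R a = rel_class R (scalar c * a)"
    by (simp add: presented_algebra_def Let_def rel_class_def)
qed

lemma subst_subst_cong:
  assumes "\<And>x. subst g (f x) - gen x \<in> rel_ideal R"
  shows "subst g (subst f a) - a \<in> rel_ideal R"
proof (induction a rule: free_alg_induct)
  case (add a b)
  show ?case using rel_ideal_add[OF add] by (simp add: algebra_simps)
next
  case (mult a b)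
  have "subst g (subst f (a * b)) - a * b
      = (subst g (subst f a) - a) * subst g (subst f b) + a * (subst g (subst f b) - b)"
    by (simp add: algebra_simps)
  then show ?case
    using mult by (simp add: rel_ideal_add rel_ideal_mult_left rel_ideal_mult_right)
qed (use assms in \<open>simp_all add: rel_ideal_zero\<close>)

text \<open>Substitutions that respect the relations descend to the quotients. They are mutually inverse
  there as soon as they are so on generators modulo the relations; since both preserve degrees, so
  does the isomorphism.\<close>
lemma presented_algebra_iso:
  assumes f_deg: "\<And>x. homogeneous wt' (wt x) (f x)"
    and g_deg: "\<And>y. homogeneous wt (wt' y) (g y)"
    and f_rel: "\<And>r. r \<in> R \<Longrightarrow> subst f r \<in> rel_ideal S"
    and g_rel: "\<And>s. s \<in> S \<Longrightarrow> subst g s \<in> rel_ideal R"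
    and gf: "\<And>x. subst g (f x) - gen x \<in> rel_ideal R"
    and fg: "\<And>y. subst f (g y) - gen y \<in> rel_ideal S"
  shows "graded_algebra_iso (presented_algebra wt R) (presented_algebra wt' S) \<noteq> {}"
proof -
  define h where "h Q = (\<Union>a\<in>Q. rel_class S (subst f a))" for Q
  have h: "h (rel_class R a) = rel_class S (subst f a)" for a
  proof -
    have "rel_class S (subst f b) = rel_class S (subst f a)" if "b \<in> rel_class R a" for b
      using that subst_rel_ideal[OF f_rel, of R "b - a"]
      by (simp add: mem_rel_class_iff rel_class_eq_iff)
    moreover have "a \<in> rel_class R a" by (simp add: mem_rel_class_iff)
    ultimately show ?thesis unfolding h_def by blast
  qed
  have fg': "rel_class S (subst f (subst g b)) = rel_class S b" for b
    using subst_subst_cong[OF fg] by (simp add: rel_class_eq_iff)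
  have inj: "a - b \<in> rel_ideal R" if "subst f a - subst f b \<in> rel_ideal S" for a b
  proof -
    have "subst g (subst f (a - b)) \<in> rel_ideal R"
      using subst_rel_ideal[OF g_rel that] by simp
    from rel_ideal_diff[OF this subst_subst_cong[OF gf, of "a - b"]] show ?thesis by simp
  qed
  have "h \<in> ring_iso (presented_algebra wt R) (presented_algebra wt' S)"
  proof (rule ring_iso_memI)
    show "bij_betw h (carrier (presented_algebra wt R)) (carrier (presented_algebra wt' S))"
      unfolding bij_betw_def presented_algebra_simps
    proof
      show "inj_on h (range (rel_class R))"
        by (auto simp: inj_on_def h rel_class_eq_iff dest: inj)
      show "h ` range (rel_class R) = range (rel_class S)"
        by (auto simp: h image_iff) (metis fg')
    qed
  qed (auto simp: presented_algebra_simps h)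
  moreover have "h ` component (presented_algebra wt R) n = component (presented_algebra wt' S) n" for n
  proof
    show "h ` component (presented_algebra wt R) n \<subseteq> component (presented_algebra wt' S) n"
      using homogeneous_subst[of wt' wt f, OF f_deg] by (auto simp: presented_algebra_simps h)
    show "component (presented_algebra wt' S) n \<subseteq> h ` component (presented_algebra wt R) n"
    proof
      fix Q assume "Q \<in> component (presented_algebra wt' S) n"
      then obtain b where b: "homogeneous wt' n b" "Q = rel_class S b"
        by (auto simp: presented_algebra_simps)
      then have "Q = h (rel_class R (subst g b))" by (simp add: h fg')
      then show "Q \<in> h ` component (presented_algebra wt R) n"
        using homogeneous_subst[of wt wt' g, OF g_deg b(1)] by (auto simp: presented_algebra_simps)
    qed
  qed
  ultimately have "h \<in> graded_algebra_iso (presented_algebra wt R) (presented_algebra wt' S)"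
    unfolding graded_algebra_iso_def by (auto simp: presented_algebra_simps(1,5) h)
  then show ?thesis by blast
qed

section \<open>The quadrics of the \<open>H\<^sub>5\<close>-Clifford algebra\<close>

lemma exhaust_5: "x = 0 \<or> x = 1 \<or> x = 2 \<or> x = 3 \<or> x = (4 :: 5)"
proof (induct x)
  case (of_int z)
  then have "0 \<le> z" "z < 5" by simp_all
  then have "z = 0 \<or> z = 1 \<or> z = 2 \<or> z = 3 \<or> z = 4" by presburger
  then show ?case by auto
qed

lemma UNIV_5: "UNIV = {0, 1, 2, 3, 4 :: 5}"
  using exhaust_5 by auto

lemma forall_5: "(\<forall>x :: 5. P x) \<longleftrightarrow> P 0 \<and> P 1 \<and> P 2 \<and> P 3 \<and> P 4"
  by (metis exhaust_5)

lemma numerals_mod_5: "(5 :: 5) = 0" "(6 :: 5) = 1" "(- 1 :: 5) = 4" "(- 2 :: 5) = 3"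
  by simp_all

lemma sum_5: "sum f (UNIV :: 5 set) = f 0 + f 1 + f 2 + f 3 + f 4"
  unfolding UNIV_5 by (simp add: add.assoc)

text \<open>The coefficient of \<open>x\<^sub>m ^ 2\<close> in \<open>x\<^sub>i x\<^sub>j + x\<^sub>j x\<^sub>i\<close> as a function of \<open>d = i - j\<close>. The pairs
  \<open>m + 1, m - 1\<close> differ by \<open>2\<close> or \<open>3 = - 2\<close>, and the pairs \<open>m + 2, m - 2\<close> by \<open>4\<close> or \<open>1 = - 4\<close>.\<close>
definition anticomm_coeff :: "complex \<Rightarrow> complex \<Rightarrow> 5 \<Rightarrow> complex" where
  "anticomm_coeff a b d = (if d = 0 then 2 else if d = 2 \<or> d = 3 then a else b)"

text \<open>Since \<open>3\<close> is the inverse of \<open>2\<close> modulo 5, the index \<open>3 * (i + j)\<close> is the midpoint of \<open>i\<close> and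
  \<open>j\<close>: each anticommutator involves a single \<open>y\<^sub>k\<close>.\<close>
definition H5_matrix :: "complex \<Rightarrow> complex \<Rightarrow> 5 \<Rightarrow> complex ^ 5 ^ 5" where
  "H5_matrix a b k = (\<chi> i j. if k = 3 * (i + j) then anticomm_coeff a b (i - j) else 0)"

lemma H5_matrix_symmetric: "transpose (H5_matrix a b k) = H5_matrix a b k"
proof -
  have "\<forall>i j :: 5. anticomm_coeff a b (i - j) = anticomm_coeff a b (j - i)"
    unfolding forall_5 anticomm_coeff_def by simp
  then show ?thesis by (simp add: H5_matrix_def transpose_def vec_eq_iff add.commute)
qed

lemma sum_H5_matrix:
  "(\<Sum>k\<in>UNIV. scalar (H5_matrix a b k $ i $ j) * y k)
    = scalar (anticomm_coeff a b (i - j)) * y (3 * (i + j))"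
proof -
  have "(\<Sum>k\<in>UNIV. scalar (H5_matrix a b k $ i $ j) * y k)
      = (\<Sum>k\<in>UNIV. if k = 3 * (i + j) then scalar (anticomm_coeff a b (i - j)) * y k else 0)"
    by (intro sum.cong) (simp_all add: H5_matrix_def scalar_zero)
  then show ?thesis by simp
qed

lemma quadric_H5_matrix:
  "quadric (H5_matrix a b k) z
    = 2 * ((z $ k)^2 + a * z $ (k + 1) * z $ (k - 1) + b * z $ (k + 2) * z $ (k - 2))"
proof -
  have "\<forall>k. quadric (H5_matrix a b k) z
    = 2 * ((z $ k)^2 + a * z $ (k + 1) * z $ (k - 1) + b * z $ (k + 2) * z $ (k - 2))"
    unfolding forall_5 quadric_def sum_5 H5_matrix_def anticomm_coeff_def
    by (simp add: numerals_mod_5 power2_eq_square algebra_simps)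
  then show ?thesis ..
qed

section \<open>The \<open>H\<^sub>5\<close>-Clifford algebra as a graded Clifford algebra\<close>

lemma rel_ideal_scalar_cancel:
  assumes "scalar c * s \<in> rel_ideal R" "c \<noteq> 0"
  shows "s \<in> rel_ideal R"
proof -
  have "scalar (1 / c) * (scalar c * s) = s"
    using assms(2) by (simp add: scalar_one flip: scalar_mult mult.assoc)
  then show ?thesis using rel_ideal_mult_left[OF assms(1), of "scalar (1 / c)"] by simp
qed

lemma scalar_diff: "scalar (c - d) = scalar c - scalar d"
  by (simp add: scalar_def single_diff)

lemma scalar_2_mult: "scalar 2 * s = s + s" for s :: "'x free_alg"
proof -
  have "scalar 2 = (1 + 1 :: 'x free_alg)"
    using scalar_add[of 1 1] by (simp add: scalar_one)
  then show ?thesis by (simp only: distrib_right mult_1_left)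
qed

lemma anticomm_mod_H5_relations:
  assumes "C \<noteq> 0"
  shows "gen i * gen j + gen j * gen i
      - scalar (anticomm_coeff (A / C) (B / C) (i - j)) * gen (3 * (i + j)) ^ 2
    \<in> rel_ideal (H5_relations A B C)" (is "?r i j \<in> ?I")
proof -
  have normalise: "s - scalar (D / C) * y \<in> ?I" if "scalar C * s - scalar D * y \<in> ?I" for D s y
  proof (rule rel_ideal_scalar_cancel[OF _ assms])
    have "scalar C * (scalar (D / C) * y) = scalar D * y"
      using assms by (simp flip: scalar_mult mult.assoc)
    then show "scalar C * (s - scalar (D / C) * y) \<in> ?I"
      using that by (simp add: right_diff_distrib)
  qed
  have A: "gen (k + 1) * gen (k - 1) + gen (k - 1) * gen (k + 1) - scalar (A / C) * gen k ^ 2 \<in> ?I" for k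
    by (rule normalise, rule rel_ideal_relation) (auto simp: H5_relations_def Let_def)
  have B: "gen (k + 2) * gen (k - 2) + gen (k - 2) * gen (k + 2) - scalar (B / C) * gen k ^ 2 \<in> ?I" for k
    by (rule normalise, rule rel_ideal_relation) (auto simp: H5_relations_def Let_def)
  let ?c = "anticomm_coeff (A / C) (B / C)" and ?m = "3 * (i + j)"
  have "\<forall>i j. (let m = 3 * (i + j) in i = j \<and> m = i
      \<or> (i = m + 1 \<and> j = m - 1 \<or> i = m - 1 \<and> j = m + 1) \<and> ?c (i - j) = A / C
      \<or> (i = m + 2 \<and> j = m - 2 \<or> i = m - 2 \<and> j = m + 2) \<and> ?c (i - j) = B / C)"
    unfolding forall_5 Let_def anticomm_coeff_def by simp
  then have "i = j \<and> ?m = i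
      \<or> (i = ?m + 1 \<and> j = ?m - 1 \<or> i = ?m - 1 \<and> j = ?m + 1) \<and> ?c (i - j) = A / C
      \<or> (i = ?m + 2 \<and> j = ?m - 2 \<or> i = ?m - 2 \<and> j = ?m + 2) \<and> ?c (i - j) = B / C"
    unfolding Let_def by (elim allE)
  then show ?thesis
  proof (elim disjE)
    assume "i = j \<and> ?m = i"
    then have m: "?m = i" and ij: "i = j" by blast+
    have "?r i j = 0"
      unfolding m unfolding ij by (simp add: anticomm_coeff_def power2_eq_square scalar_2_mult)
    then show ?thesis by (simp add: rel_ideal_zero)
  next
    assume ij: "(i = ?m + 1 \<and> j = ?m - 1 \<or> i = ?m - 1 \<and> j = ?m + 1) \<and> ?c (i - j) = A / C"
    then have "gen i * gen j + gen j * gen i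
        = gen (?m + 1) * gen (?m - 1) + gen (?m - 1) * (gen (?m + 1) :: 5 free_alg)"
      by (metis add.commute)
    then show ?thesis using A[of ?m] conjunct2[OF ij] by (simp only:)
  next
    assume ij: "(i = ?m + 2 \<and> j = ?m - 2 \<or> i = ?m - 2 \<and> j = ?m + 2) \<and> ?c (i - j) = B / C"
    then have "gen i * gen j + gen j * gen i
        = gen (?m + 2) * gen (?m - 2) + gen (?m - 2) * (gen (?m + 2) :: 5 free_alg)"
      by (metis add.commute)
    then show ?thesis using B[of ?m] conjunct2[OF ij] by (simp only:)
  qed
qed

text \<open>Modulo the relations, \<open>[x\<^sub>k ^ 2, x\<^sub>j] = [x\<^sub>k, x\<^sub>k x\<^sub>j + x\<^sub>j x\<^sub>k]\<close> is \<open>- c\<close> times \<open>[x\<^sub>m ^ 2, x\<^sub>k]\<close>, where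
  \<open>c\<close> is the anticommutator coefficient and \<open>m\<close> the midpoint. The new difference is
  \<open>m - k = (j - k) / 2 = 2 (k - j)\<close>, so the differences run through the four nonzero residues and
  the coefficients multiply to \<open>(a b) ^ 2\<close>, while the indices return to \<open>k\<close> and \<open>j\<close>.\<close>
lemma squares_central_mod_H5_relations:
  assumes C: "C \<noteq> 0" and p: "(A / C * (B / C))^2 \<noteq> 1"
  shows "gen k ^ 2 * gen j - gen j * gen k ^ 2 \<in> rel_ideal (H5_relations A B C)"
proof (cases "k = j")
  case True
  then show ?thesis by (simp add: power2_eq_square mult.assoc rel_ideal_zero)
next
  case False
  let ?I = "rel_ideal (H5_relations A B C)"
  define T where "T k j = gen k ^ 2 * gen j - gen j * gen k ^ 2" for k j :: 5
  define c where "c = anticomm_coeff (A / C) (B / C)"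
  have step: "T k j + scalar (c (k - j)) * T (3 * (k + j)) k \<in> ?I" for k j
  proof -
    let ?m = "3 * (k + j)"
    let ?r = "gen k * gen j + gen j * gen k - scalar (c (k - j)) * gen ?m ^ 2"
    have r: "?r \<in> ?I" unfolding c_def by (rule anticomm_mod_H5_relations[OF C])
    have "gen k * ?r - ?r * gen k \<in> ?I"
      by (rule rel_ideal_diff[OF rel_ideal_mult_left[OF r] rel_ideal_mult_right[OF r]])
    moreover have "gen k * (scalar (c (k - j)) * gen ?m ^ 2) = scalar (c (k - j)) * (gen k * gen ?m ^ 2)"
      by (simp only: scalar_central[of _ "gen k"] flip: mult.assoc)
    then have "gen k * ?r - ?r * gen k = T k j + scalar (c (k - j)) * T ?m k"
      by (simp add: T_def algebra_simps power2_eq_square)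
    ultimately show ?thesis by simp
  qed
  define k1 where "k1 = 3 * (k + j)"
  define k2 where "k2 = 3 * (k1 + k)"
  have idx: "3 * (k2 + k1) = j" "3 * (j + k2) = k"
    and coeffs: "c (k - j) * c (k1 - k) * c (k2 - k1) * c (j - k2) = (A / C * (B / C))^2"
  proof -
    have "\<forall>k j :: 5. k \<noteq> j \<longrightarrow>
      (let k1 = 3 * (k + j); k2 = 3 * (k1 + k) in 3 * (k2 + k1) = j \<and> 3 * (j + k2) = k
      \<and> c (k - j) * c (k1 - k) * c (k2 - k1) * c (j - k2) = (A / C * (B / C))^2)"
      unfolding forall_5 Let_def c_def anticomm_coeff_def by (simp add: power2_eq_square mult_ac)
    then show "3 * (k2 + k1) = j" "3 * (j + k2) = k"
      "c (k - j) * c (k1 - k) * c (k2 - k1) * c (j - k2) = (A / C * (B / C))^2"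
      using False unfolding k1_def k2_def Let_def by blast+
  qed
  define E where "E i j l m = T i j + scalar (c (i - j)) * T l m" for i j l m
  \<comment> \<open>The multipliers cancel the commutators with the indices \<open>k1, k\<close>, then \<open>k2, k1\<close> and \<open>j, k2\<close>.\<close>
  let ?E = "E k j k1 k - scalar (c (k - j)) * E k1 k k2 k1
      + scalar (c (k - j)) * scalar (c (k1 - k)) * E k2 k1 j k2
      - scalar (c (k - j)) * scalar (c (k1 - k)) * scalar (c (k2 - k1)) * E j k2 k j"
  have "?E = T k j - scalar ((A / C * (B / C))^2) * T k j"
    unfolding E_def coeffs[symmetric] scalar_mult by (simp add: algebra_simps)
  also have "\<dots> = scalar (1 - (A / C * (B / C))^2) * T k j"
    by (simp only: scalar_diff scalar_one left_diff_distrib mult_1_left)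
  finally have E: "?E = scalar (1 - (A / C * (B / C))^2) * T k j" .
  have "E k j k1 k \<in> ?I" "E k1 k k2 k1 \<in> ?I" "E k2 k1 j k2 \<in> ?I" "E j k2 k j \<in> ?I"
    using step[of k j] step[of k1 k] step[of k2 k1] step[of j k2]
    unfolding idx k1_def[symmetric] k2_def[symmetric] E_def by simp_all
  then have "?E \<in> ?I"
    by (intro rel_ideal_add rel_ideal_diff rel_ideal_mult_left)
  then have "T k j \<in> ?I"
    unfolding E by (rule rel_ideal_scalar_cancel) (use p in simp)
  then show ?thesis by (simp add: T_def)
qed

text \<open>The isomorphism sends \<open>x\<^sub>k\<close> to \<open>x\<^sub>k\<close>, and its inverse sends \<open>y\<^sub>k\<close> to \<open>x\<^sub>k ^ 2\<close>. The hypothesis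
  on \<open>A\<close>, \<open>B\<close>, \<open>C\<close> makes the \<open>x\<^sub>k ^ 2\<close> central, as the images of the \<open>y\<^sub>k\<close> have to be.\<close>
theorem H5_clifford_algebra_iso_graded_clifford_algebra:
  assumes C: "C \<noteq> 0" and p: "(A / C * (B / C))^2 \<noteq> 1"
  shows "graded_algebra_iso (H5_clifford_algebra A B C)
      (graded_clifford_algebra (H5_matrix (A / C) (B / C))) \<noteq> {}"
proof -
  define f :: "5 \<Rightarrow> clifford_gen free_alg" where "f k = gen (X k)" for k
  define g :: "clifford_gen \<Rightarrow> 5 free_alg" where
    "g y = (case y of X k \<Rightarrow> gen k | Y k \<Rightarrow> gen k ^ 2)" for y
  have g [simp]: "g (X k) = gen k" "g (Y k) = gen k ^ 2" for k by (simp_all add: g_def)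
  let ?c = "anticomm_coeff (A / C) (B / C)"
  let ?S = "clifford_relations (H5_matrix (A / C) (B / C))"
  let ?R = "H5_relations A B C"
  have gen_deg: "homogeneous wt (wt x) (gen x)" for wt and x :: 'z
    by (simp add: homogeneous_def gen_def)
  have subst_sq: "subst h (gen x ^ 2) = h x ^ 2" for h :: "'z \<Rightarrow> 'w free_alg" and x
    by (simp add: power2_eq_square)
  have anticomm: "f i * f j + f j * f i - scalar (?c (i - j)) * gen (Y (3 * (i + j)))
      \<in> rel_ideal ?S" for i j
    unfolding f_def clifford_relations_def sum_H5_matrix by (rule rel_ideal_relation) blast
  have square: "f k ^ 2 - gen (Y k) \<in> rel_ideal ?S" for k
  proof (rule rel_ideal_scalar_cancel)
    have "\<forall>k::5. 3 * (k + k) = k" unfolding forall_5 by simp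
    then have "3 * (k + k) = k" ..
    then show "scalar 2 * (f k ^ 2 - gen (Y k)) \<in> rel_ideal ?S"
      using anticomm[of k k]
      by (simp only: diff_self anticomm_coeff_def simp_thms if_True power2_eq_square
          right_diff_distrib scalar_2_mult)
  qed simp
  show ?thesis
    unfolding H5_clifford_algebra_def graded_clifford_algebra_def
  proof (rule presented_algebra_iso)
    show "homogeneous clifford_wt 1 (f x)" for x
      using gen_deg[of clifford_wt "X x"] by (simp add: f_def)
    show "homogeneous (\<lambda>_. 1) (clifford_wt y) (g y)" for y
      using homogeneous_mult[OF gen_deg gen_deg, of "\<lambda>_. 1"] gen_deg[of "\<lambda>_. 1"]
      by (cases y) (simp_all add: power2_eq_square numeral_2_eq_2)
    show "subst g (f x) - gen x \<in> rel_ideal ?R" for x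
      by (simp add: f_def rel_ideal_zero)
    show "subst f (g y) - gen y \<in> rel_ideal ?S" for y
      using square by (cases y) (simp_all add: subst_sq, simp add: f_def rel_ideal_zero)
    show "subst g s \<in> rel_ideal ?R" if "s \<in> ?S" for s
    proof -
      have central: "gen k ^ 2 * g y - g y * gen k ^ 2 \<in> rel_ideal ?R" for k y
      proof (cases y)
        case (Y l)
        have "gen k ^ 2 * gen l ^ 2 - gen l ^ 2 * gen k ^ 2
            = (gen k ^ 2 * gen l - gen l * gen k ^ 2) * gen l
              + gen l * (gen k ^ 2 * gen l - gen l * gen k ^ 2)"
          by (simp add: algebra_simps power2_eq_square)
        then show ?thesis
          using squares_central_mod_H5_relations[OF C p, of k l]
          by (simp add: Y rel_ideal_add rel_ideal_mult_left rel_ideal_mult_right)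
      qed (simp add: squares_central_mod_H5_relations[OF C p])
      from that consider i j where
          "s = gen (X i) * gen (X j) + gen (X j) * gen (X i)
            - scalar (?c (i - j)) * gen (Y (3 * (i + j)))"
        | k y where "s = gen (Y k) * gen y - gen y * gen (Y k)"
        unfolding clifford_relations_def sum_H5_matrix by blast
      then show ?thesis
      proof cases
        case 1
        then show ?thesis using anticomm_mod_H5_relations[OF C, of i j] by simp
      next
        case 2
        then show ?thesis using central[of k y] by simp
      qed
    qed
    show "subst f r \<in> rel_ideal ?S" if "r \<in> ?R" for r
    proof -
      have pair: "f (k + 1) * f (k - 1) + f (k - 1) * f (k + 1) - scalar (A / C) * gen (Y k) \<in> rel_ideal ?S"
        "f (k + 2) * f (k - 2) + f (k - 2) * f (k + 2) - scalar (B / C) * gen (Y k) \<in> rel_ideal ?S" for k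
      proof -
        have "\<forall>k :: 5. (k + 1) - (k - 1) = 2 \<and> 3 * ((k + 1) + (k - 1)) = k
            \<and> (k + 2) - (k - 2) = 4 \<and> 3 * ((k + 2) + (k - 2)) = k"
          unfolding forall_5 by simp
        then have "(k + 1) - (k - 1) = 2" "3 * ((k + 1) + (k - 1)) = k"
          "(k + 2) - (k - 2) = 4" "3 * ((k + 2) + (k - 2)) = k" by blast+
        note idx = this
        show "f (k + 1) * f (k - 1) + f (k - 1) * f (k + 1) - scalar (A / C) * gen (Y k) \<in> rel_ideal ?S"
          using anticomm[of "k + 1" "k - 1"] unfolding idx by (simp add: anticomm_coeff_def)
        show "f (k + 2) * f (k - 2) + f (k - 2) * f (k + 2) - scalar (B / C) * gen (Y k) \<in> rel_ideal ?S"
          using anticomm[of "k + 2" "k - 2"] unfolding idx by (simp add: anticomm_coeff_def)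
      qed
      \<comment> \<open>Each relation of the \<open>H\<^sub>5\<close>-Clifford algebra compares two multiples of the same \<open>y\<^sub>k\<close>.\<close>
      have combine: "scalar c * s - scalar d * t \<in> rel_ideal ?S"
        if "s - scalar x * y \<in> rel_ideal ?S" "t - scalar x' * y \<in> rel_ideal ?S" "c * x = d * x'"
        for c d x x' s t y
      proof -
        have "scalar c * s - scalar d * t
            = scalar c * (s - scalar x * y) - scalar d * (t - scalar x' * y)"
          using that(3) by (simp add: right_diff_distrib flip: scalar_mult mult.assoc)
        then show ?thesis using that(1,2) by (simp add: rel_ideal_diff rel_ideal_mult_left)
      qed
      have square': "f k ^ 2 - scalar 1 * gen (Y k) \<in> rel_ideal ?S" for k
        using square by (simp add: scalar_one)
      from that consider k where
          "r = scalar C * (gen (k + 1) * gen (k - 1) + gen (k - 1) * gen (k + 1)) - scalar A * gen k ^ 2"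
        | k where
          "r = scalar C * (gen (k + 2) * gen (k - 2) + gen (k - 2) * gen (k + 2)) - scalar B * gen k ^ 2"
        | k where
          "r = scalar B * (gen (k + 1) * gen (k - 1) + gen (k - 1) * gen (k + 1))
            - scalar A * (gen (k + 2) * gen (k - 2) + gen (k - 2) * gen (k + 2))"
        unfolding H5_relations_def Let_def by blast
      then show ?thesis
      proof cases
        case 1
        then show ?thesis
          using combine[OF pair(1) square', of C A] C by (simp add: subst_sq)
      next
        case 2
        then show ?thesis
          using combine[OF pair(2) square', of C B] C by (simp add: subst_sq)
      next
        case 3
        then show ?thesis
          using combine[OF pair(1) pair(2), of B A] by simp
      qed
    qed
  qed
qed

section \<open>Base points\<close>

text \<open>The hypotheses \<open>F\<close> and \<open>G\<close> are the two binary cubics, dehomogenised by \<open>t = v / u\<close>. They are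
  exchanged by \<open>a \<leftrightarrow> b\<close>, \<open>t \<leftrightarrow> 1 / t\<close>, up to a power of \<open>t\<close>. A Euclidean elimination that
  lowers the degree in \<open>t\<close> from 3 to 1 ends with a linear equation and its mirror image, and the
  determinant of these two is \<open>(1 - p) ^ 2\<close> times the product in the conclusion. The quintic
  factor of this product has a geometric meaning: it is the product of the
  \<open>1 + a \<eta> + b / \<eta>\<close> over the fifth roots of unity \<open>\<eta>\<close>, and the factor with
  \<open>\<eta> = 1\<close> vanishes exactly if \<open>(1:1:1:1:1)\<close> is a base point.\<close>
lemma no_common_root:
  fixes a b t :: complex
  defines "p \<equiv> a * b"
  assumes p: "1 - p \<noteq> 0" "1 + p \<noteq> 0"
    and t: "t \<noteq> 0"
    and F: "t * (1 - p)^2 + (a + b * t) * (b^2 - a * t)^2 = 0"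
    and G: "t^2 * (1 - p)^2 + (a + b * t) * (a^2 * t - b)^2 = 0"
  shows "(1 - 3 * p) * (1 - 5 * p + 5 * p^2 + a^5 + b^5) = 0"
proof -
  have "a + b * t \<noteq> 0" using F p(1) t by auto
  moreover have "(a + b * t) * (t * (b^2 - a * t)^2 - (a^2 * t - b)^2)
      = t * (t * (1 - p)^2 + (a + b * t) * (b^2 - a * t)^2)
        - (t^2 * (1 - p)^2 + (a + b * t) * (a^2 * t - b)^2)"
    by Groebner_Basis.algebra
  ultimately have g: "t * (b^2 - a * t)^2 - (a^2 * t - b)^2 = 0"
    unfolding F G by simp
  have "(1 + p) * (a^3 * t^2 + (1 - 3 * p) * t + b^3)
      = (t * (1 - p)^2 + (a + b * t) * (b^2 - a * t)^2)
        - b * (t * (b^2 - a * t)^2 - (a^2 * t - b)^2)"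
    unfolding p_def by Groebner_Basis.algebra
  then have q: "a^3 * t^2 + (1 - 3 * p) * t + b^3 = 0" using p(2) unfolding F g by simp
  \<comment> \<open>With this \<open>K\<close>, the linear equation has the coefficient \<open>K + a ^ 5\<close>, and its mirror image \<open>K + b ^ 5\<close>.\<close>
  define K where "K = 1 - 5 * p + 6 * p^2 - p^3"
  have "(1 - p) * ((K + a^5) * t + b^2 * (b * (1 - 2 * p) - a^4))
      = a^4 * (t * (b^2 - a * t)^2 - (a^2 * t - b)^2)
        + (1 - 3 * p + 2 * p^2 + a^5 - a^3 * t) * (a^3 * t^2 + (1 - 3 * p) * t + b^3)"
    unfolding p_def K_def by Groebner_Basis.algebra
  then have l1: "(K + a^5) * t + b^2 * (b * (1 - 2 * p) - a^4) = 0"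
    using p(1) unfolding g q by simp
  have "(1 - p) * t^2 * ((K + b^5) + a^2 * (a * (1 - 2 * p) - b^4) * t)
      = ((1 - 3 * p + 2 * p^2 + b^5) * t - b^3) * (a^3 * t^2 + (1 - 3 * p) * t + b^3)
        - b^4 * (t * (b^2 - a * t)^2 - (a^2 * t - b)^2)"
    unfolding p_def K_def by Groebner_Basis.algebra
  then have l2: "(K + b^5) + a^2 * (a * (1 - 2 * p) - b^4) * t = 0"
    using p(1) t unfolding g q by simp
  have "(1 - p)^2 * ((1 - 3 * p) * (1 - 5 * p + 5 * p^2 + a^5 + b^5))
      = (K + a^5) * ((K + b^5) + a^2 * (a * (1 - 2 * p) - b^4) * t)
        - a^2 * (a * (1 - 2 * p) - b^4) * ((K + a^5) * t + b^2 * (b * (1 - 2 * p) - a^4))"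
    unfolding p_def K_def by Groebner_Basis.algebra
  then show ?thesis using p(1) unfolding l1 l2 by simp
qed

text \<open>Multiplying the quadrics by \<open>z\<^sub>0\<close>, \<open>z\<^sub>3\<close>, \<open>z\<^sub>1\<close>, \<open>z\<^sub>4\<close>, \<open>z\<^sub>2\<close> gives five linear equations between the
  seven cubic monomials \<open>z\<^sub>i z\<^sub>j z\<^sub>k\<close> with \<open>i + j + k = 0\<close> modulo 5. As \<open>1 - p ^ 2\<close> is invertible,
  \<open>u\<close> and \<open>v\<close> determine the other five. The identities \<open>u ^ 2 v = z\<^sub>0 ^ 3 w\<^sub>1 w\<^sub>4\<close> and
  \<open>u v ^ 2 = z\<^sub>0 ^ 3 w\<^sub>2 w\<^sub>3\<close> between monomials then turn into the two binary cubics.\<close>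
lemma quadrics_imp_coordinate_zero:
  fixes a b z0 z1 z2 z3 z4 :: complex
  defines "p \<equiv> a * b"
  assumes ab: "a \<noteq> 0" "b \<noteq> 0"
    and p: "1 - p \<noteq> 0" "1 + p \<noteq> 0" "1 - 3 * p \<noteq> 0"
    and S: "1 - 5 * p + 5 * p^2 + a^5 + b^5 \<noteq> 0"
    and q: "z0^2 + a * z1 * z4 + b * z2 * z3 = 0"
      "z1^2 + a * z2 * z0 + b * z3 * z4 = 0"
      "z2^2 + a * z3 * z1 + b * z4 * z0 = 0"
      "z3^2 + a * z4 * z2 + b * z0 * z1 = 0"
      "z4^2 + a * z0 * z3 + b * z1 * z2 = 0"
  shows "z0 = 0"
proof -
  define u where "u = z0 * z1 * z4"
  define v where "v = z0 * z2 * z3"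
  define w1 where "w1 = z1^2 * z3"
  define w2 where "w2 = z2^2 * z1"
  define w3 where "w3 = z3^2 * z4"
  define w4 where "w4 = z4^2 * z2"
  note defs = u_def v_def w1_def w2_def w3_def w4_def
  have "w1 + a * v + b * w3 = z3 * (z1^2 + a * z2 * z0 + b * z3 * z4)"
    "w2 + a * w1 + b * u = z1 * (z2^2 + a * z3 * z1 + b * z4 * z0)"
    "w3 + a * w4 + b * u = z4 * (z3^2 + a * z4 * z2 + b * z0 * z1)"
    "w4 + a * v + b * w2 = z2 * (z4^2 + a * z0 * z3 + b * z1 * z2)"
    "z0^3 + a * u + b * v = z0 * (z0^2 + a * z1 * z4 + b * z2 * z3)"
    unfolding defs by (simp_all add: algebra_simps power2_eq_square power3_eq_cube)
  then have e: "w1 + a * v + b * w3 = 0" "w2 + a * w1 + b * u = 0"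
      "w3 + a * w4 + b * u = 0" "w4 + a * v + b * w2 = 0"
    and z: "z0^3 + a * u + b * v = 0"
    unfolding q by simp_all
  have "(1 + p) * (w1 - w4) = (w1 + a * v + b * w3) - (w4 + a * v + b * w2)
      + b * ((w2 + a * w1 + b * u) - (w3 + a * w4 + b * u))"
    unfolding p_def by (simp add: algebra_simps)
  then have w4: "w4 = w1" using p(2) unfolding e by simp
  have "w3 - w2 = (w3 + a * w4 + b * u) - (w2 + a * w1 + b * u)" by (simp add: w4)
  then have w3: "w3 = w2" unfolding e by simp
  have "(1 - p) * w1 - (b^2 * u - a * v) = (w1 + a * v + b * w2) - b * (w2 + a * w1 + b * u)"
    "(1 - p) * w2 - (a^2 * v - b * u) = (w2 + a * w1 + b * u) - a * (w1 + a * v + b * w2)"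
    unfolding p_def by (simp_all add: algebra_simps power2_eq_square)
  then have w: "b^2 * u - a * v = (1 - p) * w1" "a^2 * v - b * u = (1 - p) * w2"
    using e(1,2) unfolding w3 by simp_all
  have "u^2 * v = z0^3 * (w1 * w4)" "u * v^2 = z0^3 * (w2 * w3)"
    unfolding defs by (simp_all add: algebra_simps power2_eq_square power3_eq_cube)
  then have "u^2 * v * (1 - p)^2 + (a * u + b * v) * (b^2 * u - a * v)^2
      = (1 - p)^2 * w1^2 * (z0^3 + a * u + b * v)"
    "u * v^2 * (1 - p)^2 + (a * u + b * v) * (a^2 * v - b * u)^2
      = (1 - p)^2 * w2^2 * (z0^3 + a * u + b * v)"
    unfolding w w3 w4 by (simp_all add: algebra_simps power2_eq_square)
  then have F: "u^2 * v * (1 - p)^2 + (a * u + b * v) * (b^2 * u - a * v)^2 = 0"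
    and G: "u * v^2 * (1 - p)^2 + (a * u + b * v) * (a^2 * v - b * u)^2 = 0"
    unfolding z by simp_all
  have "u = 0 \<and> v = 0"
  proof (cases "u = 0 \<or> v = 0")
    case True
    \<comment> \<open>If \<open>u = 0\<close>, then \<open>F\<close> reads \<open>b a ^ 2 v ^ 3 = 0\<close>; if \<open>v = 0\<close>, it reads \<open>a b ^ 4 u ^ 3 = 0\<close>.\<close>
    then show ?thesis using F ab by (auto simp: power_mult_distrib)
  next
    case False
    define t where "t = v / u"
    have v: "v = t * u" and t: "t \<noteq> 0" using False by (simp_all add: t_def)
    have "u^3 * (t * (1 - p)^2 + (a + b * t) * (b^2 - a * t)^2) = 0"
      using F unfolding v by (simp add: algebra_simps power2_eq_square power3_eq_cube)
    moreover have "u^3 * (t^2 * (1 - p)^2 + (a + b * t) * (a^2 * t - b)^2) = 0"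
      using G unfolding v by (simp add: algebra_simps power2_eq_square power3_eq_cube)
    ultimately show ?thesis
      using no_common_root[of a b t] p t S False unfolding p_def by auto
  qed
  then show ?thesis using z by simp
qed

lemma H5_base_locus_empty:
  fixes a b :: complex
  defines "p \<equiv> a * b"
  assumes "a \<noteq> 0" "b \<noteq> 0" "1 - p \<noteq> 0" "1 + p \<noteq> 0" "1 - 3 * p \<noteq> 0"
    and "1 - 5 * p + 5 * p^2 + a^5 + b^5 \<noteq> 0"
  shows "base_locus (H5_matrix a b) = {}"
proof -
  have "z = 0" if "\<forall>k. quadric (H5_matrix a b k) z = 0" for z
  proof -
    have q: "(z $ k)^2 + a * z $ (k + 1) * z $ (k - 1) + b * z $ (k + 2) * z $ (k - 2) = 0" for k
      using that[rule_format, of k] unfolding quadric_H5_matrix mult_eq_0_iff by simp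
    have idx: "k - 1 = k + 4" "k - 2 = k + 3" "k + 5 = k" "k + 6 = k + 1"
      "k + 7 = k + 2" "k + 8 = k + 3" for k :: 5
      by (simp_all add: eq_diff_eq diff_eq_eq add.assoc)
    have "z $ k = 0" for k
    proof (rule quadrics_imp_coordinate_zero[of a b])
      show "(z $ k)^2 + a * z $ (k + 1) * z $ (k + 4) + b * z $ (k + 2) * z $ (k + 3) = 0"
        "(z $ (k + 1))^2 + a * z $ (k + 2) * z $ k + b * z $ (k + 3) * z $ (k + 4) = 0"
        "(z $ (k + 2))^2 + a * z $ (k + 3) * z $ (k + 1) + b * z $ (k + 4) * z $ k = 0"
        "(z $ (k + 3))^2 + a * z $ (k + 4) * z $ (k + 2) + b * z $ k * z $ (k + 1) = 0"
        "(z $ (k + 4))^2 + a * z $ k * z $ (k + 3) + b * z $ (k + 1) * z $ (k + 2) = 0"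
        using q[of k] q[of "k + 1"] q[of "k + 2"] q[of "k + 3"] q[of "k + 4"]
        by (simp_all only: idx add.assoc) (simp_all add: idx)
    qed (use assms in \<open>simp_all add: p_def\<close>)
    then show ?thesis by (simp add: vec_eq_iff)
  qed
  then show ?thesis unfolding base_locus_def by blast
qed

section \<open>The generic \<open>H\<^sub>5\<close>-Clifford algebra\<close>

text \<open>The homogenisation of the product of everything that has to be nonzero: \<open>a\<close> and \<open>b\<close>, then
  \<open>1 - p\<close> and \<open>1 + p\<close> (which together keep \<open>p ^ 2\<close> away from \<open>1\<close>), \<open>1 - 3 p\<close>, and the quintic
  \<open>1 - 5 p + 5 p ^ 2 + a ^ 5 + b ^ 5\<close>; the factor \<open>C\<close> makes \<open>a\<close> and \<open>b\<close> meaningful.\<close>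
definition degeneracy_form :: "3 cpoly" where
  "degeneracy_form = (let A = cvar 1; B = cvar 2; C = cvar 3 in
     A * B * C * (C^2 + cconst (-1) * (A * B)) * (C^2 + A * B) * (C^2 + cconst (-3) * (A * B))
     * (C^5 + cconst (-5) * (A * B * C^3) + cconst 5 * (A^2 * B^2 * C) + A^5 + B^5))"

lemma cpoly_homogeneous_degeneracy_form: "cpoly_homogeneous 14 degeneracy_form"
proof -
  let ?A = "cvar 1 :: 3 cpoly" and ?B = "cvar 2 :: 3 cpoly" and ?C = "cvar 3 :: 3 cpoly"
  note var = cpoly_homogeneous_cvar and pow = cpoly_homogeneous_cvar_power
  have scaled: "cpoly_homogeneous n (cconst c * p)" if "cpoly_homogeneous n p" for n c and p :: "3 cpoly"
    by (rule cpoly_homogeneous_mult[OF cpoly_homogeneous_cconst that]) simp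
  have AB: "cpoly_homogeneous 2 (?A * ?B)"
    by (rule cpoly_homogeneous_mult[OF var var]) simp
  have "cpoly_homogeneous 4 (?A^2 * ?B^2)"
    by (rule cpoly_homogeneous_mult[OF pow pow]) simp
  then have A2B2C: "cpoly_homogeneous 5 (?A^2 * ?B^2 * ?C)"
    by (rule cpoly_homogeneous_mult[OF _ var]) simp
  have ABC3: "cpoly_homogeneous 5 (?A * ?B * ?C^3)"
    by (rule cpoly_homogeneous_mult[OF AB pow]) simp
  have "cpoly_homogeneous (2 + 1 + 2 + 2 + 2 + 5) degeneracy_form"
    unfolding degeneracy_form_def Let_def
    by (rule cpoly_homogeneous_mult[OF _ _ refl] cpoly_homogeneous_add scaled pow AB A2B2C ABC3 var)+
  then show ?thesis by simp
qed

theorem theorem4p1: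
  shows "\<exists>U :: (complex ^ 3) set set. zariski_open U \<and> U \<noteq> {} \<and>
    (\<forall>A B C. proj_point (vector [A, B, C]) \<in> U \<longrightarrow>
       regular_graded_clifford_algebra (H5_clifford_algebra A B C))"
proof -
  have eval: "cpoly_eval degeneracy_form (vector [A, B, C]) =
      A * B * C * (C^2 - A * B) * (C^2 + A * B) * (C^2 - 3 * (A * B))
      * (C^5 - 5 * (A * B * C^3) + 5 * (A^2 * B^2 * C) + A^5 + B^5)" for A B C
    by (simp add: degeneracy_form_def Let_def cpoly.extend_add cpoly.extend_mult cpoly_eval_cvar
        cpoly_eval_cconst cpoly_eval_power)
  obtain U where U: "zariski_open U"
    and mem: "\<And>v. proj_point v \<in> U \<longleftrightarrow> v \<noteq> 0 \<and> cpoly_eval degeneracy_form v \<noteq> 0"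
    using nonvanishing_locus[OF cpoly_homogeneous_degeneracy_form] by blast
  have "cpoly_eval degeneracy_form (vector [1, 1, 2]) \<noteq> 0"
    unfolding eval by simp
  moreover have "(vector [1, 1, 2] :: complex ^ 3) $ 1 \<noteq> 0 $ 1"
    by simp
  then have "(vector [1, 1, 2] :: complex ^ 3) \<noteq> 0"
    by metis
  ultimately have "U \<noteq> {}" using mem by blast
  moreover have "regular_graded_clifford_algebra (H5_clifford_algebra A B C)"
    if "proj_point (vector [A, B, C]) \<in> U" for A B C
  proof -
    define a b where "a = A / C" and "b = B / C"
    have nz: "A \<noteq> 0" "B \<noteq> 0" "C \<noteq> 0" "C^2 - A * B \<noteq> 0" "C^2 + A * B \<noteq> 0" "C^2 - 3 * (A * B) \<noteq> 0"
      "C^5 - 5 * (A * B * C^3) + 5 * (A^2 * B^2 * C) + A^5 + B^5 \<noteq> 0"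
      using that unfolding mem eval by auto
    have "1 - a * b = (C^2 - A * B) / C^2" "1 + a * b = (C^2 + A * B) / C^2"
      "1 - 3 * (a * b) = (C^2 - 3 * (A * B)) / C^2"
      "1 - 5 * (a * b) + 5 * (a * b)^2 + a^5 + b^5
        = (C^5 - 5 * (A * B * C^3) + 5 * (A^2 * B^2 * C) + A^5 + B^5) / C^5"
      using nz(3) by (simp_all add: a_def b_def field_simps eval_nat_numeral)
    then have ab: "a \<noteq> 0" "b \<noteq> 0" "1 - a * b \<noteq> 0" "1 + a * b \<noteq> 0" "1 - 3 * (a * b) \<noteq> 0"
      "1 - 5 * (a * b) + 5 * (a * b)^2 + a^5 + b^5 \<noteq> 0"
      using nz by (simp_all add: a_def b_def)
    have "(a * b)^2 \<noteq> 1"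
      using ab(3,4) by (auto simp: power2_eq_1_iff)
    then have "graded_algebra_iso (H5_clifford_algebra A B C)
        (graded_clifford_algebra (H5_matrix a b)) \<noteq> {}"
      unfolding a_def b_def
      by (intro H5_clifford_algebra_iso_graded_clifford_algebra nz)
    then show ?thesis
      unfolding regular_graded_clifford_algebra_def
      using H5_matrix_symmetric H5_base_locus_empty[OF ab] by blast
  qed
  ultimately show ?thesis using U by blast
qed

end
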